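(* Let $R$ be a finite commutative local principal ring of cardinality $q^n$, where $R/J(R)\cong GF(q)$. Then \[ |\operatorname{IN}(M_2(R))|=|\operatorname{NI}(M_2(R))|=q^{3n-2}(q^n+q^2-1). \]
   Context: Rings are with identity; a principal ring is one in which every ideal is principal. $J(R)$ is the Jacobson radical of $R$ and $GF(q)$ is the field with $q$ elements. $M_2(R)$ is the ring of $2\times 2$ matrices over $R$. $\operatorname{IN}(M_2(R))$ is the set of all matrices $A\in M_2(R)$ that can be written as $A=EN$ with $E\in M_2(R)$ idempotent and $N\in M_2(R)$ nilpotent; $\operatorname{NI}(M_2(R))$ is the set of all matrices $A\in M_2(R)$ that can be written as $A=NE$ with $N\in M_2(R)$ nilpotent and $E\in M_2(R)$ idempotent. *)

theory Defs
  imports "HOL-Algebra.QuotRing" "HOL-Algebra.Algebraic_Closure_Type"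
    "Jordan_Normal_Form.Matrix"
begin

definition local_ring :: "('a, 'b) ring_scheme \<Rightarrow> bool"
  where "local_ring R \<longleftrightarrow> ring R \<and> (\<exists>!M. maximalideal M R)"

definition principal_ring :: "('a, 'b) ring_scheme \<Rightarrow> bool"
  where "principal_ring R \<longleftrightarrow> ring R \<and> (\<forall>I. ideal I R \<longrightarrow> principalideal I R)"

text \<open>Intersecting two-sided maximal ideals gives the Jacobson radical only of a
  commutative ring; the definition is not meant for other rings.\<close>

definition jacobson_radical :: "('a, 'b) ring_scheme \<Rightarrow> 'a set"
  where "jacobson_radical R = carrier R \<inter> \<Inter> {M. maximalideal M R}"

definition idempotents :: "('a, 'b) ring_scheme \<Rightarrow> 'a set"
  where "idempotents R = {e \<in> carrier R. e \<otimes>\<^bsub>R\<^esub> e = e}"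

definition nilpotents :: "('a, 'b) ring_scheme \<Rightarrow> 'a set"
  where "nilpotents R = {x \<in> carrier R. \<exists>k::nat. x [^]\<^bsub>R\<^esub> k = \<zero>\<^bsub>R\<^esub>}"

definition IN :: "('a, 'b) ring_scheme \<Rightarrow> 'a set"
  where "IN R = {a \<in> carrier R. \<exists>e \<in> idempotents R. \<exists>x \<in> nilpotents R. a = e \<otimes>\<^bsub>R\<^esub> x}"

definition NI :: "('a, 'b) ring_scheme \<Rightarrow> 'a set"
  where "NI R = {a \<in> carrier R. \<exists>x \<in> nilpotents R. \<exists>e \<in> idempotents R. a = x \<otimes>\<^bsub>R\<^esub> e}"

abbreviation M2 :: "'a::semiring_1 itself \<Rightarrow> 'a mat ring"
  where "M2 ty \<equiv> ring_mat ty 2 ()"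

end

theory Submission
  imports Defs
begin

text \<open>Let \<open>J\<close> be the set of nonunits of \<open>R\<close>. A matrix \<open>A\<close> lies in \<open>IN\<close> iff either its trace and
  determinant lie in \<open>J\<close> (that is, \<open>A\<close> is nilpotent), or its trace is a unit and its determinant
  is \<open>0\<close>: in \<open>A = E N\<close> the idempotent \<open>det E\<close> is \<open>0\<close> or \<open>1\<close>, and in the second case \<open>E\<close> is the
  identity. Conversely, a singular matrix with unit trace is an outer product, which factors
  explicitly. Both kinds of matrices are counted entry by entry in terms of \<open>card R = q card J\<close>,
  and transposition exchanges \<open>IN\<close> and \<open>NI\<close>.\<close>

section \<open>Two-by-two matrices\<close>

definition mat2 :: "'a \<Rightarrow> 'a \<Rightarrow> 'a \<Rightarrow> 'a \<Rightarrow> 'a mat"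
  where "mat2 a b c d = mat 2 2 (\<lambda>(i, j). [[a, b], [c, d]] ! i ! j)"

definition tr2 :: "'a::comm_ring_1 mat \<Rightarrow> 'a"
  where "tr2 A = A $$ (0, 0) + A $$ (1, 1)"

definition det2 :: "'a::comm_ring_1 mat \<Rightarrow> 'a"
  where "det2 A = A $$ (0, 0) * A $$ (1, 1) - A $$ (0, 1) * A $$ (1, 0)"

lemma mat2_carrier [simp]: "mat2 a b c d \<in> carrier_mat 2 2"
  by (simp add: mat2_def)

lemma mat2_index [simp]:
  "mat2 a b c d $$ (0, 0) = a" "mat2 a b c d $$ (0, Suc 0) = b"
  "mat2 a b c d $$ (Suc 0, 0) = c" "mat2 a b c d $$ (Suc 0, Suc 0) = d"
  by (simp_all add: mat2_def)

lemma mat2_eq_iff [simp]: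
  "mat2 a b c d = mat2 a' b' c' d' \<longleftrightarrow> a = a' \<and> b = b' \<and> c = c' \<and> d = d'"
  by (metis mat2_index)

lemma eq_mat2I:
  assumes "A \<in> carrier_mat 2 2" "A $$ (0, 0) = a" "A $$ (0, Suc 0) = b"
    "A $$ (Suc 0, 0) = c" "A $$ (Suc 0, Suc 0) = d"
  shows "A = mat2 a b c d"
  using assms by (intro eq_matI) (auto simp: mat2_def less_2_cases_iff numeral_2_eq_2 less_Suc_eq)

lemma mat2_cases:
  assumes "A \<in> carrier_mat 2 2"
  obtains a b c d where "A = mat2 a b c d"
  using eq_mat2I[OF assms] by blast

text \<open>Reduces equality of sets of matrices to entries; used for the case split of
  \<open>IN\<close> and for the disjointness of its pieces.\<close>

lemma eq_mat2_setI:
  assumes "S \<subseteq> carrier_mat 2 2" "T \<subseteq> carrier_mat 2 2"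
    and "\<And>a b c d. mat2 a b c d \<in> S \<longleftrightarrow> mat2 a b c d \<in> T"
  shows "S = T"
  using assms by (metis mat2_cases subsetD subsetI subset_antisym)

lemma carrier_mat_2_eq: "carrier_mat 2 2 = (\<lambda>(a, b, c, d). mat2 a b c d) ` UNIV"
  by (auto simp: image_iff elim!: mat2_cases)

lemma mat2_mult [simp]:
  "mat2 a b c d * mat2 a' b' c' d' =
    mat2 (a * a' + b * c') (a * b' + b * d') (c * a' + d * c') (c * b' + d * d')"
  for a :: "'a::comm_ring_1"
  by (rule eq_mat2I)
     (auto simp: mat2_def scalar_prod_def numeral_2_eq_2)

lemma one_mat_2: "1\<^sub>m 2 = mat2 1 0 0 (1 :: 'a::comm_ring_1)"
  by (rule eq_mat2I) auto

lemma zero_mat_2: "0\<^sub>m 2 2 = mat2 0 0 0 (0 :: 'a::comm_ring_1)"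
  by (rule eq_mat2I) auto

lemma tr2_mat2 [simp]: "tr2 (mat2 a b c d) = a + d"
  by (simp add: tr2_def)

lemma det2_mat2 [simp]: "det2 (mat2 a b c d) = a * d - b * c"
  by (simp add: det2_def)

lemma transpose_mat2 [simp]: "transpose_mat (mat2 a b c d) = mat2 a c b d"
  by (rule eq_mat2I) (auto simp: mat2_def)

section \<open>Determinants, traces and powers\<close>

lemma det2_mult:
  assumes "A \<in> carrier_mat 2 2" "B \<in> carrier_mat 2 2"
  shows "det2 (A * B) = det2 A * det2 B"
proof -
  obtain a b c d a' b' c' d' where "A = mat2 a b c d" "B = mat2 a' b' c' d'"
    using assms by (metis mat2_cases)
  then show ?thesis by (simp add: algebra_simps)
qed

lemma det2_pow:
  assumes "A \<in> carrier_mat 2 2"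
  shows "det2 (A ^\<^sub>m k) = det2 A ^ k"
proof (induction k)
  case 0
  then show ?case using assms by (simp add: one_mat_2)
next
  case (Suc k)
  then show ?case using assms by (simp add: det2_mult mult.commute)
qed

text \<open>Cayley--Hamilton, multiplied by \<open>B\<close> and traced.\<close>

lemma tr2_mult_mult:
  assumes "A \<in> carrier_mat 2 2" "B \<in> carrier_mat 2 2"
  shows "tr2 (B * A * A) = tr2 A * tr2 (B * A) - det2 A * tr2 B"
proof -
  obtain a b c d a' b' c' d' where "A = mat2 a b c d" "B = mat2 a' b' c' d'"
    using assms by (metis mat2_cases)
  then show ?thesis by (simp add: algebra_simps)
qed

lemma pow_mat_add:
  assumes "A \<in> carrier_mat n n"
  shows "A ^\<^sub>m (i + j) = A ^\<^sub>m i * A ^\<^sub>m j"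
proof (induction j)
  case 0
  then show ?case using assms by simp
next
  case (Suc j)
  then show ?case using assms by (simp add: assoc_mult_mat[of _ n n _ n _ n])
qed

lemma transpose_pow_mat:
  fixes A :: "'a::comm_semiring_1 mat"
  assumes "A \<in> carrier_mat n n"
  shows "transpose_mat (A ^\<^sub>m k) = transpose_mat A ^\<^sub>m k"
proof (induction k)
  case 0
  then show ?case using assms by simp
next
  case (Suc k)
  \<comment> \<open>The recursion of \<open>^\<^sub>m\<close> appends a factor on the right, while
    transposition moves it to the left; powers of one matrix commute.\<close>
  have "transpose_mat A ^\<^sub>m (Suc k) = transpose_mat A * transpose_mat A ^\<^sub>m k"
    using pow_mat_add[of "transpose_mat A" n 1 k] assms by simp
  with Suc show ?case using assms by (simp add: transpose_mult[of _ n n _ n])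
qed

section \<open>Idempotents, nilpotents and transposition\<close>

lemma idempotents_M2:
  "idempotents (M2 TYPE('a::comm_ring_1)) = {E \<in> carrier_mat 2 2. E * E = E}"
  by (simp add: idempotents_def ring_mat_simps)

lemma nilpotents_M2:
  "nilpotents (M2 TYPE('a::comm_ring_1)) = {N \<in> carrier_mat 2 2. \<exists>k. N ^\<^sub>m k = 0\<^sub>m 2 2}"
  by (auto simp: nilpotents_def ring_mat_simps pow_mat_ring_pow[of _ 2 _ "()"])

lemma IN_M2:
  "A \<in> IN (M2 TYPE('a::comm_ring_1)) \<longleftrightarrow>
    (\<exists>E \<in> idempotents (M2 TYPE('a)). \<exists>N \<in> nilpotents (M2 TYPE('a)). A = E * N)"
  by (auto simp: IN_def idempotents_M2 nilpotents_M2 ring_mat_simps)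

lemma NI_M2:
  "A \<in> NI (M2 TYPE('a::comm_ring_1)) \<longleftrightarrow>
    (\<exists>N \<in> nilpotents (M2 TYPE('a)). \<exists>E \<in> idempotents (M2 TYPE('a)). A = N * E)"
  by (auto simp: NI_def idempotents_M2 nilpotents_M2 ring_mat_simps)

lemma transpose_idempotents_M2:
  assumes "E \<in> idempotents (M2 TYPE('a::comm_ring_1))"
  shows "transpose_mat E \<in> idempotents (M2 TYPE('a))"
  using assms by (auto simp: idempotents_M2 simp flip: transpose_mult[of _ 2 2 _ 2])

lemma transpose_nilpotents_M2:
  assumes "N \<in> nilpotents (M2 TYPE('a::comm_ring_1))"
  shows "transpose_mat N \<in> nilpotents (M2 TYPE('a))"
proof -
  obtain k where "N \<in> carrier_mat 2 2" "N ^\<^sub>m k = 0\<^sub>m 2 2"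
    using assms by (auto simp: nilpotents_M2)
  then have "transpose_mat N ^\<^sub>m k = 0\<^sub>m 2 2"
    by (simp flip: transpose_pow_mat add: zero_mat_2)
  with \<open>N \<in> carrier_mat 2 2\<close> show ?thesis by (auto simp: nilpotents_M2)
qed

text \<open>Transposition is an involution that reverses products and preserves both idempotents and
  nilpotents.\<close>

lemma NI_M2_eq: "NI (M2 TYPE('a::comm_ring_1)) = transpose_mat ` IN (M2 TYPE('a))"
proof -
  have carrier: "E \<in> carrier_mat 2 2" if "E \<in> idempotents (M2 TYPE('a)) \<union> nilpotents (M2 TYPE('a))" for E
    using that by (auto simp: idempotents_M2 nilpotents_M2)
  have "transpose_mat (E * N) \<in> NI (M2 TYPE('a))"
    if "E \<in> idempotents (M2 TYPE('a))" "N \<in> nilpotents (M2 TYPE('a))" for E N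
    using that carrier transpose_idempotents_M2 transpose_nilpotents_M2
    by (auto simp: NI_M2 transpose_mult[of _ 2 2 _ 2])
  moreover have "N * E \<in> transpose_mat ` IN (M2 TYPE('a))"
    if "E \<in> idempotents (M2 TYPE('a))" "N \<in> nilpotents (M2 TYPE('a))" for E N
  proof
    show "N * E = transpose_mat (transpose_mat E * transpose_mat N)"
      using that carrier by (simp add: transpose_mult[of _ 2 2 _ 2])
    show "transpose_mat E * transpose_mat N \<in> IN (M2 TYPE('a))"
      using that transpose_idempotents_M2 transpose_nilpotents_M2 by (auto simp: IN_M2)
  qed
  ultimately show ?thesis
    by (auto simp: IN_M2) (auto simp: NI_M2)
qed

lemma card_NI_M2: "card (NI (M2 TYPE('a::comm_ring_1))) = card (IN (M2 TYPE('a)))"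
  unfolding NI_M2_eq by (rule card_image) (metis inj_onI transpose_transpose)

section \<open>Local rings\<close>

lemma card_Compl: "card (- S) = card (UNIV :: 'a set) - card S"
  for S :: "'a::finite set"
  by (simp add: Compl_eq_Diff_UNIV card_Diff_subset)

lemma card_UNIV_prod:
  "card (UNIV :: ('a::finite \<times> 'b::finite) set) = card (UNIV :: 'a set) * card (UNIV :: 'b set)"
  by (simp add: card_cartesian_product flip: UNIV_Times_UNIV)

lemma card_comp_fibre:
  assumes "finite A" "\<And>x. x \<in> A \<Longrightarrow> card {y. Q x y} = m"
    "\<And>x. x \<in> A \<Longrightarrow> finite {y. Q x y}"
  shows "card {(x, y). x \<in> A \<and> Q x y} = card A * m"
proof -
  have "{(x, y). x \<in> A \<and> Q x y} = Sigma A (\<lambda>x. {y. Q x y})" by auto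
  then show ?thesis using assms by (simp add: card_SigmaI)
qed

text \<open>A commutative ring with 1 \<noteq> 0 is local exactly when its nonunits are closed under
  addition; they then form its maximal ideal. Working on the type makes type-class arithmetic
  available.\<close>

locale finite_local_ring =
  fixes J :: "'a::{finite, comm_ring_1} set"
  assumes mem_J_iff: "x \<in> J \<longleftrightarrow> \<not> x dvd 1"
    and J_add: "x \<in> J \<Longrightarrow> y \<in> J \<Longrightarrow> x + y \<in> J"
begin

lemma J_mult [intro]: "x \<in> J \<Longrightarrow> r * x \<in> J" "x \<in> J \<Longrightarrow> x * r \<in> J"
  by (auto simp: mem_J_iff dest: dvd_mult_left dvd_mult_right)

lemma zero_in_J [simp, intro]: "0 \<in> J" by (simp add: mem_J_iff)

lemma one_notin_J [simp]: "1 \<notin> J" by (simp add: mem_J_iff)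

lemma J_uminus_iff [simp]: "- x \<in> J \<longleftrightarrow> x \<in> J" by (simp add: mem_J_iff)

lemma J_diff: "x \<in> J \<Longrightarrow> y \<in> J \<Longrightarrow> x - y \<in> J"
  using J_add[of x "- y"] by simp

lemma J_add_iff: "x \<in> J \<Longrightarrow> x + y \<in> J \<longleftrightarrow> y \<in> J" "x \<in> J \<Longrightarrow> y + x \<in> J \<longleftrightarrow> y \<in> J"
  using J_add J_diff by (metis add_diff_cancel_left' add_diff_cancel_right')+

lemma J_diff_iff: "x \<in> J \<Longrightarrow> x - y \<in> J \<longleftrightarrow> y \<in> J" "x \<in> J \<Longrightarrow> y - x \<in> J \<longleftrightarrow> y \<in> J"
  using J_add_iff[of x "- y"] J_add_iff[of "- x" y] by simp_all

text \<open>Products and divisors of units are units, so \<open>J\<close> is prime.\<close>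

lemma J_mult_iff [simp]: "x * y \<in> J \<longleftrightarrow> x \<in> J \<or> y \<in> J"
  using mult_dvd_mono[of x 1 y 1] by (auto simp: mem_J_iff dest: dvd_mult_left dvd_mult_right)

lemma J_power: "x ^ k \<in> J \<Longrightarrow> x \<in> J"
  by (induction k) auto

lemma unit_inverse:
  assumes "x \<notin> J"
  obtains y where "x * y = 1"
  using assms by (auto simp: mem_J_iff elim: dvdE)

text \<open>\<open>e\<close> and \<open>1 - e\<close> have product 0 and sum 1, so at least one of
  them is a unit and can be cancelled.\<close>

lemma idempotent_cases:
  fixes e :: 'a
  assumes "e * e = e"
  shows "e = 0 \<or> e = 1"
proof (cases "e \<in> J")
  case True
  then have "1 - e \<notin> J" using J_diff_iff(2) by auto
  then obtain y where "(1 - e) * y = 1" by (rule unit_inverse)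
  moreover have "e * (1 - e) = 0" using assms by (simp add: algebra_simps)
  ultimately show ?thesis by (metis mult.assoc mult_1_right mult_zero_left)
next
  case False
  then obtain y where "e * y = 1" by (rule unit_inverse)
  then show ?thesis using assms by (metis mult.assoc mult_1_right)
qed

section \<open>Nilpotent matrices\<close>

lemma tr2_pow:
  assumes A: "A \<in> carrier_mat 2 2" and det: "det2 A \<in> J"
  shows "tr2 (A ^\<^sub>m Suc k) - tr2 A ^ Suc k \<in> J"
\<comment> \<open>Modulo \<open>J\<close> the determinant vanishes, so by Cayley-Hamilton each
  further factor \<open>A\<close> multiplies the trace by \<open>tr2 A\<close>. The exponent starts
  at 1 because the identity has trace 2, not 1.\<close>
proof (induction k)
  case 0
  then show ?case using A by simp
next
  case (Suc k)
  have "tr2 (A ^\<^sub>m Suc (Suc k)) = tr2 A * tr2 (A ^\<^sub>m Suc k) - det2 A * tr2 (A ^\<^sub>m k)"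
    using tr2_mult_mult[OF A, of "A ^\<^sub>m k"] A by simp
  then have "tr2 (A ^\<^sub>m Suc (Suc k)) - tr2 A ^ Suc (Suc k) =
      tr2 A * (tr2 (A ^\<^sub>m Suc k) - tr2 A ^ Suc k) - det2 A * tr2 (A ^\<^sub>m k)"
    by (simp add: algebra_simps)
  with Suc det show ?case by (auto intro!: J_diff)
qed

lemma nilpotent_imp_tr2_det2:
  assumes A: "A \<in> carrier_mat 2 2" and nil: "A ^\<^sub>m k = 0\<^sub>m 2 2"
  shows "tr2 A \<in> J" "det2 A \<in> J"
proof -
  have "det2 A ^ k = 0"
    using det2_pow[OF A, of k] by (simp add: nil zero_mat_2)
  then show det: "det2 A \<in> J" by (metis J_power zero_in_J)
  \<comment> \<open>One more factor gives the exponent the form \<open>Suc k\<close> required by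
    \<open>tr2_pow\<close>.\<close>
  have "A ^\<^sub>m Suc k = 0\<^sub>m 2 2"
    using A nil by simp
  then have "- (tr2 A ^ Suc k) \<in> J"
    using tr2_pow[OF A det, of k] by (simp add: zero_mat_2)
  then show "tr2 A \<in> J" by (metis J_power J_uminus_iff)
qed

text \<open>By finiteness the powers of \<open>A\<close> repeat, so \<open>A ^\<^sub>m i\<close> is
  fixed by right multiplication with some positive power \<open>G\<close>. Since trace and
  determinant of \<open>G\<close> lie in \<open>J\<close>, the matrix \<open>1 - G\<close> is
  invertible, which forces \<open>A ^\<^sub>m i\<close> to vanish.\<close>

lemma tr2_det2_imp_nilpotent:
  fixes A :: "'a mat"
  assumes A: "A \<in> carrier_mat 2 2" and tr: "tr2 A \<in> J" and det: "det2 A \<in> J"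
  shows "\<exists>k. A ^\<^sub>m k = 0\<^sub>m 2 2"
proof -
  have "finite (carrier_mat 2 2 :: 'a mat set)"
    by (simp add: carrier_mat_2_eq)
  then have "finite (range (\<lambda>k. A ^\<^sub>m k))"
    by (rule finite_subset[rotated]) (use A in auto)
  then have "\<not> inj (\<lambda>k. A ^\<^sub>m k)"
    using finite_imageD infinite_UNIV_nat by blast
  then obtain i j where "i < j" "A ^\<^sub>m i = A ^\<^sub>m j"
    by (metis injI linorder_neqE_nat)
  then obtain p where p: "A ^\<^sub>m i = A ^\<^sub>m (i + Suc p)"
    by (metis less_iff_Suc_add add_Suc_right)
  define G where "G = A ^\<^sub>m Suc p"
  have G: "G \<in> carrier_mat 2 2"
    using A pow_carrier_mat unfolding G_def by blast
  have trG: "tr2 G \<in> J"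
    using tr2_pow[OF A det, of p] tr J_diff_iff(2)[of "tr2 A ^ Suc p"] by (auto simp: G_def)
  have detG: "det2 G \<in> J"
    unfolding G_def det2_pow[OF A] using det by auto
  have B: "A ^\<^sub>m i = A ^\<^sub>m i * G"
    using p pow_mat_add[OF A, of i "Suc p"] by (simp only: G_def)
  obtain a b c d where Bm: "A ^\<^sub>m i = mat2 a b c d"
    using A pow_carrier_mat mat2_cases by metis
  obtain e f g h where Gm: "G = mat2 e f g h"
    using G mat2_cases by metis
  \<comment> \<open>This element is the determinant of \<open>1 - G\<close>.\<close>
  have "1 - (tr2 G - det2 G) \<notin> J"
    using J_diff[OF trG detG] J_diff_iff(2)[of "tr2 G - det2 G" 1] by simp
  then obtain y where y: "(1 - (e + h - (e * h - f * g))) * y = 1"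
    using unit_inverse by (metis Gm tr2_mat2 det2_mat2)
  \<comment> \<open>Here \<open>(u, v)\<close> stands for a row of \<open>A ^\<^sub>m i\<close>. The
    identities below multiply \<open>(u, v) (1 - G) = 0\<close> by the adjugate of
    \<open>1 - G\<close>.\<close>
  have zero: "u = 0 \<and> v = 0" if "u = u * e + v * g" "v = u * f + v * h" for u v
  proof -
    have "u - u * e - v * g = 0" "v - v * h - u * f = 0"
      using that by (simp_all add: diff_diff_eq add.commute)
    moreover have "u * (1 - (e + h - (e * h - f * g))) =
        (u - u * e - v * g) * (1 - h) + (v - v * h - u * f) * g"
      by (simp add: algebra_simps)
    moreover have "v * (1 - (e + h - (e * h - f * g))) =
        (u - u * e - v * g) * f + (v - v * h - u * f) * (1 - e)"
      by (simp add: algebra_simps)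
    ultimately have "u * (1 - (e + h - (e * h - f * g))) = 0"
      "v * (1 - (e + h - (e * h - f * g))) = 0"
      by simp_all
    then show ?thesis using y by (metis mult.assoc mult_1_right mult_zero_left)
  qed
  have "A ^\<^sub>m i = 0\<^sub>m 2 2"
    using B zero[of a b] zero[of c d] by (simp add: Bm Gm zero_mat_2)
  then show ?thesis ..
qed

lemma mem_nilpotents_M2_iff:
  "N \<in> nilpotents (M2 TYPE('a)) \<longleftrightarrow> N \<in> carrier_mat 2 2 \<and> tr2 N \<in> J \<and> det2 N \<in> J"
  using nilpotent_imp_tr2_det2 tr2_det2_imp_nilpotent by (auto simp: nilpotents_M2)

section \<open>Membership in \<open>IN\<close>\<close>

lemma IN_M2_imp:
  assumes "A \<in> IN (M2 TYPE('a))"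
  shows "A \<in> nilpotents (M2 TYPE('a)) \<or> det2 A = 0"
proof -
  obtain E N where E: "E \<in> carrier_mat 2 2" "E * E = E"
    and N: "N \<in> nilpotents (M2 TYPE('a))" and A: "A = E * N"
    using assms by (auto simp: IN_M2 idempotents_M2)
  have N_carrier: "N \<in> carrier_mat 2 2"
    using N by (simp add: nilpotents_M2)
  have "det2 E * det2 E = det2 E"
    using E det2_mult by metis
  then consider "det2 E = 0" | "det2 E = 1"
    using idempotent_cases by blast
  then show ?thesis
  proof cases
    case 1
    then show ?thesis using det2_mult[OF E(1) N_carrier] A by simp
  next
    case 2
    obtain a b c d where Em: "E = mat2 a b c d"
      using E mat2_cases by metis
    \<comment> \<open>The adjugate inverts \<open>E\<close>, so one factor can be cancelled from
      \<open>E * E = E\<close>.\<close>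
    have adj: "mat2 d (- b) (- c) a * E = 1\<^sub>m 2"
      using 2 by (simp add: Em one_mat_2 algebra_simps)
    then have "E = mat2 d (- b) (- c) a * E * E"
      using E(1) by simp
    also have "\<dots> = mat2 d (- b) (- c) a * (E * E)"
      using E(1) by (intro assoc_mult_mat[of _ 2 2 _ 2 _ 2]) auto
    finally have "E = 1\<^sub>m 2" by (simp add: E(2) adj)
    then show ?thesis using N N_carrier A by simp
  qed
qed

text \<open>For \<open>x = (- w2, w1)\<close> we have \<open>w\<^sup>T x = 0\<close>, and \<open>(v, x)\<close> has determinant \<open>w\<^sup>T v\<close>, so some
  \<open>u\<close> satisfies \<open>u\<^sup>T v = u\<^sup>T x = 1\<close>. Then \<open>v w\<^sup>T = (v u\<^sup>T) (x w\<^sup>T)\<close>.\<close>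

lemma outer_product_mem_IN:
  assumes "v1 * w1 + v2 * w2 \<notin> J"
  shows "mat2 (v1 * w1) (v1 * w2) (v2 * w1) (v2 * w2) \<in> IN (M2 TYPE('a))"
proof -
  let ?t = "v1 * w1 + v2 * w2"
  have outer_mult: "mat2 (a1 * b1) (a1 * b2) (a2 * b1) (a2 * b2) *
      mat2 (c1 * d1) (c1 * d2) (c2 * d1) (c2 * d2) =
      mat2 (a1 * (b1 * c1 + b2 * c2) * d1) (a1 * (b1 * c1 + b2 * c2) * d2)
        (a2 * (b1 * c1 + b2 * c2) * d1) (a2 * (b1 * c1 + b2 * c2) * d2)"
    for a1 a2 b1 b2 c1 c2 d1 d2 :: 'a
    by (simp add: algebra_simps)
  obtain y where y: "?t * y = 1" using assms by (rule unit_inverse)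
  \<comment> \<open>Cramer's rule for the two equations \<open>uv\<close> and \<open>ux\<close>,
    whose determinant is \<open>?t\<close>.\<close>
  define u1 where "u1 = (w1 - v2) * y"
  define u2 where "u2 = (w2 + v1) * y"
  have uv: "u1 * v1 + u2 * v2 = 1" and ux: "u1 * - w2 + u2 * w1 = 1"
  proof -
    have "u1 * v1 + u2 * v2 = ?t * y" "u1 * - w2 + u2 * w1 = ?t * y"
      by (simp_all add: u1_def u2_def algebra_simps)
    then show "u1 * v1 + u2 * v2 = 1" "u1 * - w2 + u2 * w1 = 1" using y by simp_all
  qed
  let ?E = "mat2 (v1 * u1) (v1 * u2) (v2 * u1) (v2 * u2)"
  let ?N = "mat2 (- w2 * w1) (- w2 * w2) (w1 * w1) (w1 * w2)"
  have "?E \<in> idempotents (M2 TYPE('a))"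
    unfolding idempotents_M2 mem_Collect_eq outer_mult uv by simp
  \<comment> \<open>Both trace and determinant of \<open>?N\<close> are 0.\<close>
  moreover have "?N \<in> nilpotents (M2 TYPE('a))"
    by (simp add: mem_nilpotents_M2_iff algebra_simps)
  moreover have "mat2 (v1 * w1) (v1 * w2) (v2 * w1) (v2 * w2) = ?E * ?N"
    unfolding outer_mult ux by simp
  ultimately show ?thesis unfolding IN_M2 by blast
qed

text \<open>A unit trace makes \<open>a\<close> or \<open>d\<close> a unit. Dividing by it writes
  the matrix as the column \<open>(1, c / a)\<close> times the row \<open>(a, b)\<close>, or as the
  column \<open>(b / d, 1)\<close> times the row \<open>(c, d)\<close>.\<close>

lemma singular_mem_IN:
  assumes det: "a * d = b * c" and tr: "a + d \<notin> J"
  shows "mat2 a b c d \<in> IN (M2 TYPE('a))"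
proof -
  have "a \<notin> J \<or> d \<notin> J" using tr J_add by blast
  then show ?thesis
  proof
    assume "a \<notin> J"
    then obtain z where z: "a * z = 1" by (rule unit_inverse)
    have "c * z * a = c * (a * z)" "c * z * b = a * d * z" by (simp_all add: det ac_simps)
    moreover have "a * d * z = d * (a * z)" by (simp add: ac_simps)
    ultimately show ?thesis using outer_product_mem_IN[of 1 a "c * z" b] tr z by simp
  next
    assume "d \<notin> J"
    then obtain z where z: "d * z = 1" by (rule unit_inverse)
    have "b * z * d = b * (d * z)" "b * z * c = a * d * z" by (simp_all add: det ac_simps)
    moreover have "a * d * z = a * (d * z)" by (simp add: ac_simps)
    ultimately show ?thesis using outer_product_mem_IN[of "b * z" c 1 d] tr z by simp
  qed
qed

lemma mat2_mem_IN_iff: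
  "mat2 a b c d \<in> IN (M2 TYPE('a)) \<longleftrightarrow>
    (a + d \<in> J \<and> a * d - b * c \<in> J) \<or> (a + d \<notin> J \<and> a * d = b * c)"
proof -
  \<comment> \<open>For a nilpotent matrix the identity serves as the idempotent factor.\<close>
  have "1\<^sub>m 2 * N \<in> IN (M2 TYPE('a))" if "N \<in> nilpotents (M2 TYPE('a))" for N
    unfolding IN_M2 using that by (intro bexI[of _ "1\<^sub>m 2"] bexI[of _ N]) (auto simp: idempotents_M2)
  then have "N \<in> IN (M2 TYPE('a))" if "N \<in> nilpotents (M2 TYPE('a))" for N
    using that by (metis left_mult_one_mat mem_nilpotents_M2_iff)
  then show ?thesis
    using IN_M2_imp[of "mat2 a b c d"] singular_mem_IN
    by (auto simp: mem_nilpotents_M2_iff)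
qed

lemma IN_M2_subset_carrier: "IN (M2 TYPE('a)) \<subseteq> carrier_mat 2 2"
  by (auto simp: IN_def ring_mat_simps)

subsection \<open>Counting\<close>

text \<open>For a unit \<open>b\<close> the affine map permutes the ring; its inverse sends
  \<open>z\<close> to \<open>y * (z - x)\<close>.\<close>

lemma card_unit_affine:
  assumes "b \<notin> J"
  shows "card {c. x + b * c \<in> S} = card S"
proof -
  obtain y where y: "b * y = 1" using assms by (rule unit_inverse)
  have "inj_on (\<lambda>c. x + b * c) {c. x + b * c \<in> S}"
    using y by (auto intro!: inj_onI) (metis mult.assoc mult.commute mult_1)
  moreover have "z = x + b * (y * (z - x))" for z
    using y by (simp flip: mult.assoc)
  then have "(\<lambda>c. x + b * c) ` {c. x + b * c \<in> S} = S"
    by (auto simp: image_iff) (metis)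
  ultimately show ?thesis using card_image by metis
qed

text \<open>If \<open>b\<close> were in \<open>J\<close>, the sum would be a unit like
  \<open>x\<close>. Hence \<open>b\<close> is a unit, and each such \<open>b\<close> leaves
  \<open>card J\<close> values of \<open>c\<close>.\<close>

lemma card_mult_add_mem_J:
  assumes "x \<notin> J"
  shows "card {(b, c). x + b * c \<in> J} = card (- J) * card J"
proof -
  have "{(b, c). x + b * c \<in> J} = {(b, c). b \<in> - J \<and> x + b * c \<in> J}"
    using assms by (auto simp: J_add_iff)
  then show ?thesis
    using card_comp_fibre[of "- J" "\<lambda>b c. x + b * c \<in> J" "card J"] by (simp add: card_unit_affine)
qed

text \<open>The first summand counts the nilpotent matrices, the second the singular matrices with
  unit trace.\<close>

lemma card_IN_M2:
  "card (IN (M2 TYPE('a))) = card J ^ 2 * card (UNIV :: 'a set) ^ 2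
    + card (- J) * card (UNIV :: 'a set) * (card (UNIV :: 'a set) + card J)"
proof -
  let ?r = "card (UNIV :: 'a set)" and ?j = "card J" and ?u = "card (- J)"
  have r: "?r = ?u + ?j"
    using card_Un_disjoint[of "- J" J] by simp
  \<comment> \<open>Nilpotent, \<open>b\<close> a unit. As \<open>d\<close> is \<open>- a\<close>
    modulo \<open>J\<close>, the determinant condition becomes \<open>a * a + b * c \<in> J\<close>,
    free of \<open>d\<close>.\<close>
  define T1 where "T1 = {(p, s).
    p \<in> UNIV \<times> (- J) \<and> fst p + snd s \<in> J \<and> fst p * fst p + snd p * fst s \<in> J}"
  \<comment> \<open>Nilpotent, \<open>b\<close> in \<open>J\<close>: then \<open>a * a\<close> is in
    \<open>J\<close>, hence so are \<open>a\<close> and \<open>d\<close>, while \<open>c\<close> is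
    arbitrary.\<close>
  define T2 where "T2 = J \<times> J \<times> (UNIV :: 'a set) \<times> J"
  \<comment> \<open>Singular with unit trace, \<open>a\<close> a unit: \<open>d\<close> is
    determined by the other entries. As \<open>a * (a + d) = a * a + b * c\<close>, the trace
    condition does not involve \<open>d\<close> and goes into \<open>A3\<close>.\<close>
  define A3 where "A3 = {(a, p). a \<in> - J \<and> a * a + fst p * snd p \<notin> J}"
  define T3 where "T3 = {(p, d). p \<in> A3 \<and> fst p * d = fst (snd p) * snd (snd p)}"
  \<comment> \<open>Singular with unit trace, \<open>a\<close> in \<open>J\<close>: then
    \<open>d\<close> is a unit and \<open>b * c = a * d\<close> lies in \<open>J\<close>. Now
    \<open>a\<close> is the determined entry and comes last in the tuple.\<close>
  define A4 where "A4 = (- J) \<times> {(b, c). b * c \<in> J}"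
  define T4 where "T4 = {(p, a). p \<in> A4 \<and> a * fst p = fst (snd p) * snd (snd p)}"
  define f1 where "f1 = (\<lambda>((a, b), c, d). mat2 a b c (d :: 'a))"
  define f2 where "f2 = (\<lambda>(a, b, c, d). mat2 a b c (d :: 'a))"
  define f3 where "f3 = (\<lambda>((a, b, c), d). mat2 a b c (d :: 'a))"
  define f4 where "f4 = (\<lambda>((d, b, c), a). mat2 a b c (d :: 'a))"
  note T_defs = T1_def T2_def A3_def T3_def A4_def T4_def
  note f_defs = f1_def f2_def f3_def f4_def
  have "card {s. a + snd s \<in> J \<and> a * a + b * fst s \<in> J} = ?j * ?j" if "b \<notin> J" for a b
  proof -
    \<comment> \<open>For fixed \<open>a\<close> and \<open>b\<close> the conditions on
      \<open>c\<close> and \<open>d\<close> are independent; the factor 1 fits the second to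
      \<open>card_unit_affine\<close>.\<close>
    have "{s. a + snd s \<in> J \<and> a * a + b * fst s \<in> J} =
        {c. a * a + b * c \<in> J} \<times> {d. a + 1 * d \<in> J}"
      by auto
    then show ?thesis
      using that card_unit_affine[of 1 a J] by (simp add: card_unit_affine card_cartesian_product)
  qed
  then have T1: "card T1 = card ((UNIV :: 'a set) \<times> (- J)) * (?j * ?j)"
    unfolding T1_def by (intro card_comp_fibre) auto
  have T2: "card T2 = ?j * (?j * (?r * ?j))"
    by (simp add: T2_def card_cartesian_product)
  have A3: "card A3 = ?u * (?r * ?r - ?u * ?j)"
  proof -
    have "card {p. a * a + fst p * snd p \<notin> J} = ?r * ?r - ?u * ?j" if "a \<notin> J" for a
    proof -
      have "{p. a * a + fst p * snd p \<notin> J} = - {(b, c). a * a + b * c \<in> J}" by auto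
      then show ?thesis
        using card_mult_add_mem_J[of "a * a"] that
        by (simp add: card_Compl card_UNIV_prod)
    qed
    then show ?thesis
      unfolding A3_def by (subst card_comp_fibre) auto
  qed
  have A4: "card A4 = ?u * (?r * ?r - ?u * ?u)"
  proof -
    have "{(b, c). b * c \<in> J} = - ((- J) \<times> (- J))" by auto
    then show ?thesis
      by (simp add: A4_def card_Compl card_UNIV_prod card_cartesian_product)
  qed
  have unique: "card {d. a * d = x} = 1" if "a \<notin> J" for a x
    using card_unit_affine[OF that, of 0 "{x}"] by simp
  have T3: "card T3 = card A3 * 1"
    unfolding T3_def by (rule card_comp_fibre) (use unique in \<open>auto simp: A3_def\<close>)
  have T4: "card T4 = card A4 * 1"
    unfolding T4_def
    by (rule card_comp_fibre) (use unique in \<open>auto simp: A4_def mult.commute\<close>)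
  have trace_J: "a * d - b * c \<in> J \<longleftrightarrow> a * a + b * c \<in> J" if "a + d \<in> J" for a b c d
  proof -
    have "a * d - b * c = a * (a + d) - (a * a + b * c)" by (simp add: algebra_simps)
    moreover have "a * (a + d) \<in> J" using that by (rule J_mult)
    ultimately show ?thesis by (simp only: J_diff_iff)
  qed
  have det_0: "a + d \<in> J \<longleftrightarrow> a * a + b * c \<in> J" if "a \<notin> J" "a * d = b * c" for a b c d
  proof -
    have "a * a + b * c = a * (a + d)" using that(2) by (simp add: distrib_left)
    then show ?thesis using that(1) by (simp only: J_mult_iff simp_thms)
  qed
  have image: "mat2 a b c d \<in> f1 ` S1 \<longleftrightarrow> ((a, b), c, d) \<in> S1"
    "mat2 a b c d \<in> f2 ` S2 \<longleftrightarrow> (a, b, c, d) \<in> S2"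
    "mat2 a b c d \<in> f3 ` S3 \<longleftrightarrow> ((a, b, c), d) \<in> S3"
    "mat2 a b c d \<in> f4 ` S4 \<longleftrightarrow> ((d, b, c), a) \<in> S4"
    for S1 S2 S3 S4 a b c d
    by (force simp: f_defs)+
  have mem1: "mat2 a b c d \<in> f1 ` T1 \<longleftrightarrow> b \<notin> J \<and> a + d \<in> J \<and> a * d - b * c \<in> J" for a b c d
    using trace_J[of a d b c] unfolding image T1_def by auto
  have mem2: "mat2 a b c d \<in> f2 ` T2 \<longleftrightarrow> b \<in> J \<and> a + d \<in> J \<and> a * d - b * c \<in> J" for a b c d
    using trace_J[of a d b c] J_add_iff(2)[of "b * c" "a * a"] J_add_iff(1)[of a d]
    unfolding image T2_def by (auto simp only: J_mult_iff mem_Times_iff fst_conv snd_conv UNIV_I)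
  have mem3: "mat2 a b c d \<in> f3 ` T3 \<longleftrightarrow> a \<notin> J \<and> a + d \<notin> J \<and> a * d = b * c" for a b c d
    using det_0[of a d b c] unfolding image T3_def A3_def by auto
  have mem4: "mat2 a b c d \<in> f4 ` T4 \<longleftrightarrow> a \<in> J \<and> a + d \<notin> J \<and> a * d = b * c" for a b c d
  proof -
    have "a \<in> J \<or> d \<in> J \<longleftrightarrow> b * c \<in> J" if "a * d = b * c"
      unfolding that[symmetric] by (rule J_mult_iff[symmetric])
    then show ?thesis
      using J_add_iff(1)[of a d] J_add[of a d] unfolding image T4_def A4_def by auto
  qed
  note mem = mem1 mem2 mem3 mem4
  have carrier: "f1 ` T1 \<subseteq> carrier_mat 2 2" "f2 ` T2 \<subseteq> carrier_mat 2 2"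
    "f3 ` T3 \<subseteq> carrier_mat 2 2" "f4 ` T4 \<subseteq> carrier_mat 2 2"
    by (auto simp: f_defs)
  have IN: "IN (M2 TYPE('a)) = (f1 ` T1 \<union> f2 ` T2) \<union> (f3 ` T3 \<union> f4 ` T4)"
  proof (rule eq_mat2_setI)
    show "mat2 a b c d \<in> IN (M2 TYPE('a)) \<longleftrightarrow>
        mat2 a b c d \<in> (f1 ` T1 \<union> f2 ` T2) \<union> (f3 ` T3 \<union> f4 ` T4)" for a b c d
      unfolding Un_iff mem mat2_mem_IN_iff by blast
  qed (use carrier IN_M2_subset_carrier in auto)
  have disjoint: "f1 ` T1 \<inter> f2 ` T2 = {}" "f3 ` T3 \<inter> f4 ` T4 = {}"
    "(f1 ` T1 \<union> f2 ` T2) \<inter> (f3 ` T3 \<union> f4 ` T4) = {}"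
    by (rule eq_mat2_setI; use carrier in \<open>auto simp only: mem Int_iff Un_iff empty_iff\<close>)+
  have inj: "inj_on f1 T1" "inj_on f2 T2" "inj_on f3 T3" "inj_on f4 T4"
    by (auto simp: inj_on_def f_defs)
  have "card (IN (M2 TYPE('a))) = card T1 + card T2 + (card T3 + card T4)"
    unfolding IN using disjoint inj by (simp add: card_Un_disjoint card_image)
  also have "\<dots> = ?j ^ 2 * ?r ^ 2 + ?u * ?r * (?r + ?j)"
  proof -
    \<comment> \<open>Expanding \<open>?r\<close> as \<open>?u + ?j\<close> resolves the truncated
      subtractions.\<close>
    have "?r * ?r - ?u * ?j + (?r * ?r - ?u * ?u) = ?r * (?r + ?j)"
      unfolding r by (simp add: algebra_simps)
    then have "?u * (?r * ?r - ?u * ?j) + ?u * (?r * ?r - ?u * ?u) = ?u * ?r * (?r + ?j)"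
      by (metis distrib_left mult.assoc)
    moreover have "?r * ?u * (?j * ?j) + ?j * (?j * (?r * ?j)) = ?j ^ 2 * ?r ^ 2"
      unfolding r by (simp add: algebra_simps power2_eq_square)
    ultimately show ?thesis by (simp add: T1 T2 T3 T4 A3 A4 card_cartesian_product)
  qed
  finally show ?thesis .
qed

end

section \<open>Residue fields\<close>

text \<open>A finite ring has finitely many ideals, so a maximal proper ideal above \<open>I\<close>
  exists without Zorn's lemma.\<close>

lemma (in ring) finite_exists_maximalideal:
  assumes "finite (carrier R)" "ideal I R" "I \<noteq> carrier R"
  obtains M where "maximalideal M R" "I \<subseteq> M"
proof -
  let ?P = "\<lambda>K. ideal K R \<and> I \<subseteq> K \<and> K \<noteq> carrier R"
  have sub: "K \<subseteq> carrier R" if "ideal K R" for K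
    using that by (auto dest: ideal.Icarr)
  have "{K. ?P K} \<subseteq> Pow (carrier R)"
    using sub by blast
  then have "finite {K. ?P K}"
    using assms(1) by (simp add: finite_subset)
  moreover have "I \<in> {K. ?P K}"
    using assms(2,3) by simp
  ultimately obtain M where M: "?P M" and maximal: "\<forall>K \<in> {K. ?P K}. M \<subseteq> K \<longrightarrow> M = K"
    using finite_has_maximal[of "{K. ?P K}"] by auto
  have "maximalideal M R"
  proof (rule maximalidealI)
    show "ideal M R" "carrier R \<noteq> M" using M by auto
    show "K = M \<or> K = carrier R" if "ideal K R" "M \<subseteq> K" for K
      using that M maximal by (metis (mono_tags, lifting) mem_Collect_eq order_trans)
  qed
  then show thesis using M by (intro that) auto
qed

text \<open>The radical is the unique maximal ideal \<open>M\<close>. A nonunit generates a proper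
  ideal, which must lie in \<open>M\<close>; a unit in \<open>M\<close> would make \<open>M\<close>
  the whole ring.\<close>

lemma (in cring) local_ring_jacobson_radical:
  assumes "finite (carrier R)" "local_ring R"
  shows "maximalideal (jacobson_radical R) R"
    and "jacobson_radical R = carrier R - Units R"
proof -
  obtain M where M: "maximalideal M R" and unique: "\<And>K. maximalideal K R \<Longrightarrow> K = M"
    using assms(2) unfolding local_ring_def by (metis (no_types))
  interpret M: maximalideal M R by fact
  have "{K. maximalideal K R} = {M}" using M unique by blast
  then have J: "jacobson_radical R = M"
    using M.a_subset by (auto simp: jacobson_radical_def)
  show "maximalideal (jacobson_radical R) R" by (simp add: J M)
  have "x \<in> M" if x: "x \<in> carrier R" "x \<notin> Units R" for x
  proof -
    have "\<one> \<notin> PIdl x"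
      using x by (auto simp: cgenideal_def Units_def) (metis m_comm)
    then have "PIdl x \<noteq> carrier R" by auto
    then obtain K where "maximalideal K R" "PIdl x \<subseteq> K"
      using finite_exists_maximalideal[OF assms(1) cgenideal_ideal[OF x(1)]] by blast
    then show ?thesis using cgenideal_self[OF x(1)] unique by blast
  qed
  moreover have "x \<notin> M" if "x \<in> Units R" for x
    using that M.I_l_closed[of x "inv x"] M.one_imp_carrier M.I_notcarr
    by (metis Units_inv_closed Units_l_inv)
  ultimately show "jacobson_radical R = carrier R - Units R"
    using M.a_subset by (auto simp: J)
qed

lemma card_Quot:
  assumes "ideal I R" "finite (carrier R)"
  shows "card (carrier (R Quot I)) * card I = card (carrier R)"
proof -
  interpret ideal I R by fact
  show ?thesis
    using a_lagrange[OF assms(2)] is_additive_subgroup by (simp add: FactRing_def Coset.order_def)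
qed

section \<open>The count in terms of \<open>q\<close> and \<open>n\<close>\<close>

theorem theorem3p10:
  fixes R :: "'a::{finite, comm_ring_1} ring"
    and F :: "('k, 'm) ring_scheme"
    and q n :: nat
  assumes "R = ring_of_type_algebra"
    and "local_ring R" and "principal_ring R"
    and "field F" and "finite (carrier F)" and "card (carrier F) = q"
    and "(R Quot jacobson_radical R) \<simeq> F"
    and "card (carrier R) = q ^ n"
  shows "card (IN (M2 TYPE('a))) = q ^ (3 * n - 2) * (q ^ n + q\<^sup>2 - 1) \<and>
         card (NI (M2 TYPE('a))) = q ^ (3 * n - 2) * (q ^ n + q\<^sup>2 - 1)"
proof -
  interpret R: cring R unfolding assms(1) by (rule cring_from_type_algebra)
  interpret F: field F by fact
  define J where "J = jacobson_radical R"
  have carrier: "carrier R = UNIV" and finite: "finite (carrier R)"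
    by (simp_all add: assms(1) ring_of_type_algebra_def)
  interpret J: maximalideal J R
    unfolding J_def using R.local_ring_jacobson_radical(1) finite assms(2) by blast
  have "J = carrier R - Units R"
    unfolding J_def using R.local_ring_jacobson_radical(2) finite assms(2) by blast
  also have "\<dots> = {x. \<not> x dvd 1}"
    by (auto simp: assms(1) ring_of_type_algebra_def Units_def dvd_def) (metis mult.commute)+
  finally have J_eq: "J = {x. \<not> x dvd 1}" .
  interpret finite_local_ring J
  proof
    show "x \<in> J \<longleftrightarrow> \<not> x dvd 1" for x by (simp add: J_eq)
    show "x + y \<in> J" if "x \<in> J" "y \<in> J" for x y
      using J.a_closed[OF that] by (simp add: assms(1) ring_of_type_algebra_def)
  qed
  obtain h where "bij_betw h (carrier (R Quot J)) (carrier F)"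
    using assms(7) by (auto simp: is_ring_iso_def ring_iso_def J_def)
  then have "card (carrier (R Quot J)) = q"
    using bij_betw_same_card assms(6) by blast
  then have qj: "q * card J = q ^ n"
    using card_Quot[OF J.is_ideal finite] assms(8) by simp
  have "q > 0" using F.one_closed assms(5,6) card_gt_0_iff by blast
  \<comment> \<open>Since 0 and 1 differ, \<open>n\<close> is positive; so
    \<open>card J = q ^ (n - 1)\<close> and \<open>3 * n - 2\<close> is not truncated.\<close>
  have "card (UNIV :: 'a set) \<noteq> 1"
    by (metis UNIV_I card_1_singletonE singletonD zero_neq_one)
  then have "n \<noteq> 0" using assms(8) carrier by auto
  then obtain m where n: "n = Suc m" by (cases n) auto
  then have j: "card J = q ^ m" using qj \<open>q > 0\<close> by simp
  have r: "card (UNIV :: 'a set) = q ^ Suc m" using assms(8) carrier n by simp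
  have u: "card (- J) = q ^ Suc m - q ^ m" by (simp add: card_Compl r j)
  have "card (IN (M2 TYPE('a))) = q ^ (3 * n - 2) * (q ^ n + q\<^sup>2 - 1)"
  proof -
    \<comment> \<open>With \<open>k = q - 1\<close> the subtractions disappear: there are
      \<open>k * q ^ m\<close> units, and \<open>q\<^sup>2 - 1\<close> is
      \<open>k * (q + 1)\<close>.\<close>
    obtain k where k: "q = Suc k" using \<open>q > 0\<close> by (cases q) auto
    have u': "card (- J) = k * q ^ m" by (simp add: u k)
    have "q\<^sup>2 = k * (q + 1) + 1" by (simp add: k power2_eq_square)
    then have "q ^ n + q\<^sup>2 - 1 = q ^ Suc m + k * (q + 1)"
      by (simp add: n)
    moreover have "3 * n - 2 = Suc (m + m + m)" by (simp add: n)
    then have "q ^ (3 * n - 2) = q * (q ^ m * q ^ m * q ^ m)" by (simp add: power_add)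
    ultimately show ?thesis
      unfolding card_IN_M2 u' r j by (simp add: algebra_simps power2_eq_square)
  qed
  then show ?thesis using card_NI_M2[where 'a = 'a] by simp
qed

end
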